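(* Let $m\ge 4$ be an integer (so that $S=\{2,m\}$ is admissible). Then $$p(\{2,m\};n)=(m-3)\binom{n-2}{m-1}+(m-2)\binom{n-2}{m-2}-\binom{n-2}{1},$$ i.e. $\#P(\{2,m\};n)=p(\{2,m\};n)\,2^{n-3}$ for all $n\ge m+1$.
   Context: For a permutation $\pi=a_1\ldots a_n$ of $\{1,\ldots,n\}$, an index $i$ is a peak if $a_{i-1}<a_i>a_{i+1}$. $P(S;n)$ is the set of permutations of $\{1,\dots,n\}$ whose set of peaks is exactly $S$. For an admissible finite set $S$ (i.e. $\#P(S;n)\neq 0$ for some $n$), the peak polynomial $p(S;n)$ is the unique polynomial with $\#P(S;n)=p(S;n)2^{n-\#S-1}$ for all $n>\max S$. *)

theory Defs
  imports
    "HOL-Combinatorics.Permutations"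
    "HOL-Computational_Algebra.Polynomial"
    Complex_Main
begin

text \<open>
  A permutation of \<open>{1..n}\<close> is a function \<open>\<pi>\<close> with \<open>\<pi> permutes {1..n}\<close>; its one-line notation is
  \<open>\<pi> 1 \<dots> \<pi> n\<close>. Such a function is the identity outside \<open>{1..n}\<close>, so the range of the index has
  to be restricted explicitly: the end points are never peaks.
\<close>

definition peaks :: "nat \<Rightarrow> (nat \<Rightarrow> nat) \<Rightarrow> nat set" where
  "peaks n \<pi> = {i. 1 < i \<and> i < n \<and> \<pi> (i - 1) < \<pi> i \<and> \<pi> i > \<pi> (i + 1)}"

definition peak_perms :: "nat set \<Rightarrow> nat \<Rightarrow> (nat \<Rightarrow> nat) set" where
  "peak_perms S n = {\<pi>. \<pi> permutes {1..n} \<and> peaks n \<pi> = S}"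

definition admissible :: "nat set \<Rightarrow> bool" where
  "admissible S \<longleftrightarrow> finite S \<and> (\<exists>n. card (peak_perms S n) \<noteq> 0)"

text \<open>
  Inserting \<open>0\<close> fixes the convention that the maximum of the empty set is \<open>0\<close>. For admissible \<open>S\<close>
  and \<open>n\<close> above the maximum, \<open>n \<ge> card S + 1\<close>, so the truncated subtraction is exact.
\<close>

definition peak_polynomial :: "nat set \<Rightarrow> real poly" where
  "peak_polynomial S =
     (THE p. \<forall>n > Max (insert 0 S).
        real (card (peak_perms S n)) = poly p (real n) * 2 ^ (n - card S - 1))"

end

theory Submission
  imports Defs "HOL-Combinatorics.Multiset_Permutations"
begin

text \<open>
  Cut a permutation of an \<open>n\<close>-element set after position \<open>k\<close>, requiring peak set \<open>S\<close> to the left of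
  the cut and no peaks to the right of it. The whole permutation then has peak set \<open>S\<close>, \<open>S \<union> {k}\<close> or
  \<open>S \<union> {k + 1}\<close>, so that
  \<open>#P(S;n) + #P(S \<union> {k};n) + #P(S \<union> {k+1};n) = (n choose k) #P(S;k) #P({};n-k)\<close>.
  A permutation without peaks has its maximum at one of its ends, so \<open>#P({};n) = 2^(n-1)\<close>. The recurrence
  with \<open>k = 1\<close> then gives \<open>#P({2};n) = (n-2) 2^(n-2)\<close>, and with \<open>S = {2}\<close> it determines \<open>#P({2,m};n)\<close>
  by induction on \<open>m\<close>, starting from \<open>#P({2,3};n) = 0\<close>. Permutations are handled as lists with a given
  set of entries; as all counts depend on the size of that set only, no standardization is needed.
\<close>

text \<open>Peaks are counted from \<open>1\<close>, as in \<^const>\<open>peaks\<close>, whereas \<open>!\<close> counts from \<open>0\<close>.\<close>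

definition list_peaks :: "'a::linorder list \<Rightarrow> nat set" where
  "list_peaks xs = {i. 1 < i \<and> i < length xs \<and> xs ! (i - 2) < xs ! (i - 1) \<and> xs ! (i - 1) > xs ! i}"

definition peak_lists :: "nat set \<Rightarrow> 'a::linorder set \<Rightarrow> 'a list set" where
  "peak_lists S A = {xs \<in> permutations_of_set A. list_peaks xs = S}"

lemma finite_peak_lists [simp]: "finite (peak_lists S A)"
  by (simp add: peak_lists_def)

section \<open>Effect of cutting on the peaks of a list\<close>

lemma list_peaks_take: "list_peaks (take k xs) = list_peaks xs \<inter> {..<k}"
  by (auto simp: list_peaks_def)

text \<open>The condition \<open>1 < i\<close> discards a peak of \<open>xs\<close> at
  \<open>k + 1\<close>: its left neighbour is cut off, and the first entry of a list is never a
  peak.\<close>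

lemma list_peaks_drop: "list_peaks (drop k xs) = {i. 1 < i \<and> i + k \<in> list_peaks xs}"
proof -
  have "Suc (i + k) - 2 = i + k - 1" "i + k - 2 = k + (i - 2)" "i + k - 1 = k + (i - 1)"
    if "1 < i" for i using that by auto
  then show ?thesis
    by (auto simp: list_peaks_def add.commute)
qed

lemma list_peaks_not_adjacent:
  assumes "i \<in> list_peaks xs"
  shows "Suc i \<notin> list_peaks xs"
  using assms by (auto simp: list_peaks_def)

lemma list_peaks_bounds:
  assumes "i \<in> list_peaks xs"
  shows "1 < i" "i < length xs"
  using assms by (auto simp: list_peaks_def)

section \<open>Counting lists by cutting them after position k\<close>

lemma permutations_of_set_split:
  assumes "finite A" "k \<le> card A"
  shows "{xs \<in> permutations_of_set A. P (take k xs) \<and> Q (drop k xs)} =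
    (\<Union>B\<in>{B. B \<subseteq> A \<and> card B = k}. (\<lambda>(ys, zs). ys @ zs) `
      ({ys \<in> permutations_of_set B. P ys} \<times> {zs \<in> permutations_of_set (A - B). Q zs}))"
    (is "?L = ?R")
proof
  show "?L \<subseteq> ?R"
  proof
    fix xs assume "xs \<in> ?L"
    then have xs: "set xs = A" "distinct xs" "P (take k xs)" "Q (drop k xs)"
      by (auto simp: permutations_of_set_def)
    let ?B = "set (take k xs)"
    have len: "length xs = card A" using xs by (metis distinct_card)
    have "?B \<subseteq> A" using xs(1) by (metis set_take_subset)
    moreover have "card ?B = k" using xs assms len by (simp add: distinct_card)
    moreover have "?B \<union> set (drop k xs) = A"
      by (metis append_take_drop_id set_append xs(1))
    moreover have "?B \<inter> set (drop k xs) = {}"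
      using xs(2) by (simp add: set_take_disj_set_drop_if_distinct)
    ultimately show "xs \<in> ?R"
      using xs by (intro UN_I[of ?B] image_eqI[of _ _ "(take k xs, drop k xs)"])
        (auto simp: permutations_of_set_def)
  qed
  show "?R \<subseteq> ?L"
  proof
    fix xs assume "xs \<in> ?R"
    then obtain B ys zs where *: "xs = ys @ zs" "B \<subseteq> A" "card B = k" "set ys = B" "distinct ys" "P ys"
      "set zs = A - B" "distinct zs" "Q zs"
      by (auto simp: permutations_of_set_def)
    moreover have "length ys = k" using * by (metis distinct_card)
    ultimately show "xs \<in> ?L" by (auto simp: permutations_of_set_def)
  qed
qed

text \<open>Concatenation is injective here because the first part has fixed length k. Different B
  give disjoint families, as B is recovered as the set of the first k entries.\<close>

lemma card_permutations_of_set_split: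
  assumes "finite A" "k \<le> card A"
  shows "card {xs \<in> permutations_of_set A. P (take k xs) \<and> Q (drop k xs)} =
    (\<Sum>B\<in>{B. B \<subseteq> A \<and> card B = k}.
      card {ys \<in> permutations_of_set B. P ys} * card {zs \<in> permutations_of_set (A - B). Q zs})"
proof -
  let ?X = "\<lambda>B. {ys \<in> permutations_of_set B. P ys} \<times> {zs \<in> permutations_of_set (A - B). Q zs}"
  have len: "length ys = k \<and> set ys = B"
    if "card B = k" "ys \<in> permutations_of_set B" for ys B
    using that by (auto simp: permutations_of_set_def distinct_card)
  have inj: "inj_on (\<lambda>(ys, zs). ys @ zs) (?X B)" if "card B = k" for B
    using len[OF that] by (auto intro!: inj_onI)
  have "card (\<Union>B\<in>{B. B \<subseteq> A \<and> card B = k}. (\<lambda>(ys, zs). ys @ zs) ` ?X B) =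
      (\<Sum>B\<in>{B. B \<subseteq> A \<and> card B = k}. card ((\<lambda>(ys, zs). ys @ zs) ` ?X B))"
  proof (rule card_UN_disjoint)
    show "finite {B. B \<subseteq> A \<and> card B = k}" using assms by simp
    show "\<forall>B\<in>{B. B \<subseteq> A \<and> card B = k}. finite ((\<lambda>(ys, zs). ys @ zs) ` ?X B)" by simp
    show "\<forall>B\<in>{B. B \<subseteq> A \<and> card B = k}. \<forall>C\<in>{B. B \<subseteq> A \<and> card B = k}. B \<noteq> C \<longrightarrow>
        (\<lambda>(ys, zs). ys @ zs) ` ?X B \<inter> (\<lambda>(ys, zs). ys @ zs) ` ?X C = {}"
    proof (intro ballI impI equals0I)
      fix B C xs
      assume B: "B \<in> {B. B \<subseteq> A \<and> card B = k}" and C: "C \<in> {B. B \<subseteq> A \<and> card B = k}"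
        and ne: "B \<noteq> C"
        and xs: "xs \<in> (\<lambda>(ys, zs). ys @ zs) ` ?X B \<inter> (\<lambda>(ys, zs). ys @ zs) ` ?X C"
      have "set (take k xs) = D" if "card D = k" "xs \<in> (\<lambda>(ys, zs). ys @ zs) ` ?X D" for D
        using that(2) len[OF that(1)] by auto
      then have "set (take k xs) = B" "set (take k xs) = C" using xs B C by blast+
      then show False using ne by simp
    qed
  qed
  also have "\<dots> = (\<Sum>B\<in>{B. B \<subseteq> A \<and> card B = k}.
      card {ys \<in> permutations_of_set B. P ys} * card {zs \<in> permutations_of_set (A - B). Q zs})"
    by (intro sum.cong refl) (simp add: card_image[OF inj] card_cartesian_product)
  finally show ?thesis by (simp only: permutations_of_set_split[OF assms])
qed

text \<open>Exactly the positions k and k + 1 have a neighbour across the cut, so the two parts show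
  every peak except those. Being adjacent, they cannot both be peaks, which leaves three
  cases.\<close>

lemma split_peaks_iff:
  assumes "S \<subseteq> {..<k}"
  shows "list_peaks (take k xs) = S \<and> list_peaks (drop k xs) = {} \<longleftrightarrow>
    list_peaks xs \<in> {S, insert k S, insert (Suc k) S}"
proof -
  let ?P = "list_peaks xs"
  have drop: "list_peaks (drop k xs) = {} \<longleftrightarrow> ?P \<subseteq> {..Suc k}"
  proof
    assume *: "list_peaks (drop k xs) = {}"
    show "?P \<subseteq> {..Suc k}"
    proof
      fix i assume "i \<in> ?P"
      then have "\<not> 1 < i - k \<or> \<not> k \<le> i" using * by (auto simp: list_peaks_drop)
      then show "i \<in> {..Suc k}" by auto
    qed
  qed (auto simp: list_peaks_drop)
  have "?P \<inter> {..<k} = S \<and> ?P \<subseteq> {..Suc k} \<longleftrightarrow> ?P \<in> {S, insert k S, insert (Suc k) S}"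
  proof
    assume *: "?P \<inter> {..<k} = S \<and> ?P \<subseteq> {..Suc k}"
    have "{..Suc k} = {..<k} \<union> {k, Suc k}" by auto
    then have "?P = S \<union> (?P \<inter> {k, Suc k})" using * by blast
    then show "?P \<in> {S, insert k S, insert (Suc k) S}"
      using list_peaks_not_adjacent[of k xs]
      by (cases "k \<in> ?P"; cases "Suc k \<in> ?P") auto
  next
    assume "?P \<in> {S, insert k S, insert (Suc k) S}"
    then show "?P \<inter> {..<k} = S \<and> ?P \<subseteq> {..Suc k}" using assms by fastforce
  qed
  then show ?thesis by (simp only: drop list_peaks_take)
qed

lemma card_peak_lists_split:
  fixes A :: "'a::linorder set"
  assumes "finite A" "k \<le> card A" "S \<subseteq> {..<k}"
  shows "card (peak_lists S A) + card (peak_lists (insert k S) A) + card (peak_lists (insert (Suc k) S) A) =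
    (\<Sum>B\<in>{B. B \<subseteq> A \<and> card B = k}. card (peak_lists S B) * card (peak_lists {} (A - B)))"
proof -
  have "S \<noteq> insert k S" "S \<noteq> insert (Suc k) S" "insert k S \<noteq> insert (Suc k) S"
    using assms(3) by auto
  then have "card (peak_lists S A \<union> peak_lists (insert k S) A \<union> peak_lists (insert (Suc k) S) A) =
      card (peak_lists S A) + card (peak_lists (insert k S) A) + card (peak_lists (insert (Suc k) S) A)"
    by (subst card_Un_disjoint; (subst card_Un_disjoint)?; auto simp: peak_lists_def)
  moreover have "peak_lists S A \<union> peak_lists (insert k S) A \<union> peak_lists (insert (Suc k) S) A =
      {xs \<in> permutations_of_set A. list_peaks (take k xs) = S \<and> list_peaks (drop k xs) = {}}"
    unfolding split_peaks_iff[OF assms(3)] by (auto simp: peak_lists_def)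
  ultimately show ?thesis
    using card_permutations_of_set_split[OF assms(1,2),
        of "\<lambda>ys. list_peaks ys = S" "\<lambda>zs. list_peaks zs = {}"]
    by (simp add: peak_lists_def)
qed

section \<open>Lists without peaks\<close>

text \<open>Prepending shifts all positions by one, so only emptiness is compared. The only
  candidate for a new peak is position 2, the old first entry, and it lies below its left neighbour
  \<open>M\<close>.\<close>

lemma list_peaks_Max_Cons:
  assumes "\<And>y. y \<in> set ys \<Longrightarrow> y < M"
  shows "list_peaks (M # ys) = {} \<longleftrightarrow> list_peaks ys = {}"
proof -
  have 2: "2 \<notin> list_peaks (M # ys)"
  proof
    assume "2 \<in> list_peaks (M # ys)"
    then have "M < ys ! 0" "1 < length ys" by (auto simp: list_peaks_def)
    then show False using assms[of "ys ! 0"] by (cases ys) auto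
  qed
  have "list_peaks ys = {i. 1 < i \<and> i + 1 \<in> list_peaks (M # ys)}"
    using list_peaks_drop[of 1 "M # ys"] by simp
  moreover have "\<exists>j. 1 < j \<and> i = j + 1" if "i \<in> list_peaks (M # ys)" for i
  proof (intro exI conjI)
    have "1 < i" "i \<noteq> 2" using that 2 list_peaks_bounds(1) by blast+
    then show "1 < i - 1" "i = i - 1 + 1" by auto
  qed
  ultimately show ?thesis by fast
qed

text \<open>Appending shifts nothing, so the peak sets themselves agree. The only candidate for a
  new peak is the last entry of \<open>ys\<close>, which lies below \<open>M\<close>.\<close>

lemma list_peaks_Max_snoc:
  assumes "\<And>y. y \<in> set ys \<Longrightarrow> y < M"
  shows "list_peaks (ys @ [M]) = list_peaks ys"
proof -
  have "length ys \<notin> list_peaks (ys @ [M])"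
  proof
    assume "length ys \<in> list_peaks (ys @ [M])"
    then have "1 < length ys" "M < ys ! (length ys - 1)"
      by (auto simp: list_peaks_def nth_append split: if_splits)
    then show False using assms[of "ys ! (length ys - 1)"] by auto
  qed
  then have "list_peaks (ys @ [M]) \<subseteq> {..<length ys}"
    using list_peaks_bounds(2)[of _ "ys @ [M]"] by (auto simp: less_Suc_eq)
  then show ?thesis using list_peaks_take[of "length ys" "ys @ [M]"] by auto
qed

text \<open>A maximum with neighbours on both sides would be a peak; at either end it creates
  none.\<close>

lemma peak_lists_empty_eq_Max_at_end:
  assumes "finite A" "A \<noteq> {}"
  shows "peak_lists {} A = (#) (Max A) ` peak_lists {} (A - {Max A}) \<union>
    (\<lambda>ys. ys @ [Max A]) ` peak_lists {} (A - {Max A})"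
    (is "?L = ?C \<union> ?D")
proof -
  have M: "Max A \<in> A" using assms by simp
  have lt: "y < Max A" if "y \<in> A" "y \<noteq> Max A" for y
    using that assms by (simp add: order.not_eq_order_implies_strict)
  have peakC: "list_peaks (Max A # ys) = {} \<longleftrightarrow> list_peaks ys = {}"
    and peakD: "list_peaks (ys @ [Max A]) = list_peaks ys" if "set ys = A - {Max A}" for ys
    using that lt list_peaks_Max_Cons[of ys] list_peaks_Max_snoc[of ys] by auto
  show ?thesis
  proof
    show "?C \<union> ?D \<subseteq> ?L"
      using M peakC peakD by (auto simp: peak_lists_def permutations_of_set_def)
    show "?L \<subseteq> ?C \<union> ?D"
    proof
      fix xs assume "xs \<in> ?L"
      then have xs: "set xs = A" "distinct xs" "list_peaks xs = {}"
        by (auto simp: peak_lists_def permutations_of_set_def)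
      obtain us vs where eq: "xs = us @ Max A # vs"
        using M xs(1) by (metis split_list)
      have "us = [] \<or> vs = []"
      proof (rule ccontr)
        assume ne: "\<not> (us = [] \<or> vs = [])"
        have "last us \<in> set us" "hd vs \<in> set vs" using ne by auto
        then have "last us < Max A" "hd vs < Max A"
          using xs(1,2) unfolding eq by (auto intro!: lt)
        moreover have "xs ! (Suc (length us) - 2) = last us" "xs ! length us = Max A"
            "xs ! Suc (length us) = hd vs"
          using ne by (auto simp: eq nth_append last_conv_nth hd_conv_nth nth_Cons')
        ultimately have "Suc (length us) \<in> list_peaks xs"
          using ne by (auto simp: list_peaks_def eq)
        then show False using xs(3) by simp
      qed
      then show "xs \<in> ?C \<union> ?D"
      proof
        assume "us = []"
        then show ?thesis using xs eq peakC[of vs]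
          by (auto simp: peak_lists_def permutations_of_set_def)
      next
        assume "vs = []"
        then have "xs = us @ [Max A]" using eq by simp
        moreover from this have "set us = A - {Max A}" "distinct us" using xs(1,2) by auto
        ultimately have "us \<in> peak_lists {} (A - {Max A})"
          using xs(3) peakD[of us] by (simp add: peak_lists_def permutations_of_set_def)
        then show ?thesis using \<open>xs = us @ [Max A]\<close> by blast
      qed
    qed
  qed
qed

lemma card_peak_lists_empty:
  assumes "finite A" "card A = Suc n"
  shows "card (peak_lists {} A) = 2 ^ n"
  using assms
proof (induction n arbitrary: A)
  case 0
  then obtain a where "A = {a}" by (auto simp: card_Suc_eq)
  then have "peak_lists {} A = {[a]}" by (auto simp: peak_lists_def list_peaks_def)
  then show ?case by simp
next
  case (Suc n)
  let ?A = "A - {Max A}"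
  have "A \<noteq> {}" using Suc.prems by auto
  then have cA: "card ?A = Suc n" using Suc.prems by simp
  have "(#) (Max A) ` peak_lists {} ?A \<inter> (\<lambda>ys. ys @ [Max A]) ` peak_lists {} ?A = {}"
  proof (rule equals0I)
    fix xs
    assume "xs \<in> (#) (Max A) ` peak_lists {} ?A \<inter> (\<lambda>ys. ys @ [Max A]) ` peak_lists {} ?A"
    then obtain ys zs where "Max A # ys = zs @ [Max A]" "set zs = ?A"
      by (auto simp: peak_lists_def permutations_of_set_def)
    \<comment> \<open>The two ends coincide only in a one-element list, which is the base case of
      the induction.\<close>
    moreover have "?A \<noteq> {}" using cA by (metis card.empty nat.distinct(1))
    ultimately show False by (cases zs) auto
  qed
  then show ?case
    using Suc.IH[OF _ cA] Suc.prems
    by (simp add: peak_lists_empty_eq_Max_at_end[OF Suc.prems(1) \<open>A \<noteq> {}\<close>] card_Un_disjoint card_image inj_on_def)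
qed

section \<open>The recurrence and the peak sets {2} and {2, m}\<close>

text \<open>If the count for the first block is the same number c for every choice of B, the sum
  collapses. The second block is nonempty since \<open>k < card A\<close>, and contributes a power
  of 2.\<close>

lemma card_peak_lists_recurrence:
  fixes A :: "'a::linorder set"
  assumes "finite A" "k < card A" "S \<subseteq> {..<k}"
    and "\<And>B. B \<subseteq> A \<Longrightarrow> card B = k \<Longrightarrow> card (peak_lists S B) = c"
  shows "card (peak_lists S A) + card (peak_lists (insert k S) A) + card (peak_lists (insert (Suc k) S) A) =
    (card A choose k) * c * 2 ^ (card A - Suc k)"
proof -
  have "(\<Sum>B\<in>{B. B \<subseteq> A \<and> card B = k}. card (peak_lists S B) * card (peak_lists {} (A - B)))
      = (\<Sum>B\<in>{B. B \<subseteq> A \<and> card B = k}. c * 2 ^ (card A - Suc k))"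
  proof (intro sum.cong refl)
    fix B assume B: "B \<in> {B. B \<subseteq> A \<and> card B = k}"
    then have "finite B" using assms(1) finite_subset[of B A] by simp
    then have "card (A - B) = Suc (card A - Suc k)"
      using B assms(1,2) by (simp add: card_Diff_subset Suc_diff_Suc)
    then show "card (peak_lists S B) * card (peak_lists {} (A - B)) = c * 2 ^ (card A - Suc k)"
      using B assms(1,4) by (simp add: card_peak_lists_empty)
  qed
  then show ?thesis
    using assms by (simp add: card_peak_lists_split n_subsets)
qed

lemma peak_lists_no_one: "1 \<in> S \<Longrightarrow> peak_lists S A = {}"
  using list_peaks_bounds(1) by (fastforce simp: peak_lists_def)

lemma peak_lists_adjacent: "i \<in> S \<Longrightarrow> Suc i \<in> S \<Longrightarrow> peak_lists S A = {}"
  using list_peaks_not_adjacent by (fastforce simp: peak_lists_def)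

lemma card_peak_lists_2:
  assumes "finite A" "card A = n + 2"
  shows "card (peak_lists {2} A) = n * 2 ^ n"
proof -
  \<comment> \<open>Cut after the first entry: c = 1, as the single list on one element has no peak.
    The term for {1} vanishes.\<close>
  have "card (peak_lists {} A) + card (peak_lists {1} A) + card (peak_lists {Suc 1} A) =
      (card A choose 1) * 1 * 2 ^ (card A - Suc 1)"
    by (rule card_peak_lists_recurrence)
      (use assms in \<open>auto simp: card_peak_lists_empty[of _ 0] finite_subset\<close>)
  then have "2 * 2 ^ n + card (peak_lists {2} A) = (n + 2) * 2 ^ n"
    using assms by (simp add: peak_lists_no_one card_peak_lists_empty numeral_2_eq_2)
  then show ?thesis by (simp add: algebra_simps)
qed

lemma choose_add_two:
  "(n + 2) choose (k + 2) = (n choose (k + 2)) + 2 * (n choose (k + 1)) + (n choose k)"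
  by (simp add: numeral_2_eq_2)

text \<open>Here m = j + 3 and n is the size of \<open>A\<close> minus 2, the upper index of the
  binomials. Doubling replaces the factor \<open>2 ^ (n - 1)\<close> by \<open>2 ^ n\<close>, and
  real numbers make the subtractions exact.\<close>

lemma card_peak_lists_2_add_3:
  fixes A :: "'a::linorder set"
  assumes "finite A" "card A = n + 2" "j + 1 \<le> n"
  shows "real (card (peak_lists {2, j + 3} A)) * 2 =
    (real j * real (n choose (j + 2)) + real (j + 1) * real (n choose (j + 1)) - real n) * 2 ^ n"
  using assms(3)
proof (induction j)
  case 0
  \<comment> \<open>The right-hand side is also 0, since (n choose 1) - n = 0.\<close>
  have "peak_lists {2, 3} A = {}" by (rule peak_lists_adjacent[of 2]) auto
  then show ?case by simp
next
  case (Suc j)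
  have c2: "card (peak_lists {2} A) = n * 2 ^ n"
    using assms by (simp add: card_peak_lists_2)
  \<comment> \<open>The factors come from the first block of j + 3 entries with peak set {2}, from
    the second block without peaks, and from the doubling.\<close>
  have exponent: "2 ^ (j + 1) * (2::nat) ^ (n - (j + 2)) * 2 = 2 ^ n"
  proof -
    have "2 ^ (j + 1) * (2::nat) ^ (n - (j + 2)) * 2 = 2 ^ ((j + 1) + (n - (j + 2)) + 1)"
      by (simp only: power_add power_one_right)
    also have "(j + 1) + (n - (j + 2)) + 1 = n" using Suc.prems by simp
    finally show ?thesis .
  qed
  have "card (peak_lists {2} A) + card (peak_lists (insert (j + 3) {2}) A)
      + card (peak_lists (insert (Suc (j + 3)) {2}) A) =
      (card A choose (j + 3)) * ((j + 1) * 2 ^ (j + 1)) * 2 ^ (card A - Suc (j + 3))"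
  proof (rule card_peak_lists_recurrence)
    fix B assume "B \<subseteq> A" "card B = j + 3"
    then show "card (peak_lists {2} B) = (j + 1) * 2 ^ (j + 1)"
      using assms(1) by (intro card_peak_lists_2) (auto intro: finite_subset)
  qed (use assms Suc.prems in auto)
  moreover have "card A - Suc (j + 3) = n - (j + 2)" using assms by simp
  moreover have "{2, j + 3} = insert (j + 3) {2}" "{2, Suc j + 3} = insert (Suc (j + 3)) {2}"
    by auto
  ultimately have "(card (peak_lists {2} A) + card (peak_lists {2, j + 3} A)
      + card (peak_lists {2, Suc j + 3} A)) * 2 =
      ((n + 2) choose (j + 3)) * (j + 1) * (2 ^ (j + 1) * 2 ^ (n - (j + 2)) * 2)"
    by (simp only: assms(2) mult.assoc)
  then have "real ((card (peak_lists {2} A) + card (peak_lists {2, j + 3} A)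
      + card (peak_lists {2, Suc j + 3} A)) * 2) = real (((n + 2) choose (j + 3)) * (j + 1) * 2 ^ n)"
    unfolding exponent by (rule arg_cong)
  then have "real (card (peak_lists {2, Suc j + 3} A)) * 2 =
      real ((n + 2) choose (j + 3)) * (real j + 1) * 2 ^ n - 2 * (real n * 2 ^ n)
      - real (card (peak_lists {2, j + 3} A)) * 2"
    unfolding c2 by (simp add: algebra_simps)
  also have "(n + 2) choose (j + 3) =
      (n choose (j + 3)) + 2 * (n choose (j + 2)) + (n choose (j + 1))"
    using choose_add_two[of n "j + 1"] by (simp add: numeral_eq_Suc)
  also have "real (card (peak_lists {2, j + 3} A)) * 2 =
      (real j * real (n choose (j + 2)) + real (j + 1) * real (n choose (j + 1)) - real n) * 2 ^ n"
    using Suc by simp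
  finally show ?case
    by (simp add: algebra_simps numeral_eq_Suc)
qed

section \<open>From permutations as functions to lists\<close>

lemma card_peak_perms: "card (peak_perms S n) = card (peak_lists S {1..n})"
proof -
  let ?f = "\<lambda>\<pi>::nat \<Rightarrow> nat. map \<pi> [1..<Suc n]"
  have inj: "inj_on ?f {\<pi>. \<pi> permutes {1..n}}"
  proof (rule inj_onI, rule ext)
    fix \<pi> \<sigma> x
    assume "\<pi> \<in> {\<pi>. \<pi> permutes {1..n}}" "\<sigma> \<in> {\<pi>. \<pi> permutes {1..n}}" "?f \<pi> = ?f \<sigma>"
    then show "\<pi> x = \<sigma> x"
      by (cases "x \<in> {1..n}") (auto simp: permutes_not_in simp del: upt_Suc)
  qed
  have "?f ` {\<pi>. \<pi> permutes {1..n}} \<subseteq> permutations_of_set {1..n}"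
  proof (intro image_subsetI)
    fix \<pi> assume "\<pi> \<in> {\<pi>. \<pi> permutes {1..n}}"
    then have \<pi>: "\<pi> permutes {1..n}" by simp
    have "{1..<Suc n} = {1..n}" by auto
    then show "?f \<pi> \<in> permutations_of_set {1..n}"
      using permutes_image[OF \<pi>] permutes_inj_on[OF \<pi>]
      by (auto simp: permutations_of_set_def distinct_map simp del: upt_Suc)
  qed
  \<comment> \<open>Both sides have n! elements, so injectivity and the inclusion already give
    surjectivity.\<close>
  moreover have "card (?f ` {\<pi>. \<pi> permutes {1..n}}) = card (permutations_of_set {1..n})"
    unfolding card_image[OF inj] using card_permutations[of "{1..n}" n] by simp
  ultimately have image: "?f ` {\<pi>. \<pi> permutes {1..n}} = permutations_of_set {1..n}"
    by (intro card_subset_eq) auto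
  have peaks: "list_peaks (?f \<pi>) = peaks n \<pi>" for \<pi>
  proof -
    have "?f \<pi> ! (i - 2) = \<pi> (i - 1)" "?f \<pi> ! (i - 1) = \<pi> i" "?f \<pi> ! i = \<pi> (i + 1)"
      if "1 < i" "i < n" for i
    proof -
      have "Suc (i - 2) = i - 1" "Suc (i - 1) = i" using that by auto
      then show "?f \<pi> ! (i - 2) = \<pi> (i - 1)" "?f \<pi> ! (i - 1) = \<pi> i" "?f \<pi> ! i = \<pi> (i + 1)"
        using that by (simp_all del: upt_Suc)
    qed
    then show ?thesis by (auto simp: list_peaks_def peaks_def simp del: upt_Suc)
  qed
  have "peak_lists S {1..n} = ?f ` peak_perms S n"
    unfolding peak_lists_def peak_perms_def image[symmetric] peaks[symmetric] by blast
  moreover have "inj_on ?f (peak_perms S n)"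
    by (rule inj_on_subset[OF inj]) (auto simp: peak_perms_def)
  ultimately show ?thesis by (simp add: card_image del: upt_Suc)
qed

section \<open>Identifying the peak polynomial\<close>

definition gchoose_poly :: "nat \<Rightarrow> 'a::field_char_0 poly" where
  "gchoose_poly k = smult (1 / fact k) (\<Prod>i = 0..<k. [:- of_nat i, 1:])"

lemma poly_gchoose_poly [simp]: "poly (gchoose_poly k) x = x gchoose k"
  by (simp add: gchoose_poly_def gbinomial_prod_rev poly_prod)

text \<open>The difference would otherwise be a nonzero polynomial with infinitely many roots. This
  supplies the uniqueness behind \<open>THE\<close> in \<open>peak_polynomial\<close>.\<close>

lemma poly_eq_if_eventually_eq_on_nat:
  fixes p q :: "'a::{idom, ring_char_0} poly"
  assumes "\<And>n. n > N \<Longrightarrow> poly p (of_nat n) = poly q (of_nat n)"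
  shows "p = q"
proof (rule ccontr)
  assume "p \<noteq> q"
  then have "finite {x. poly (p - q) x = 0}" by (intro poly_roots_finite) simp
  moreover have "of_nat ` {N<..} \<subseteq> {x. poly (p - q) x = 0}" using assms by auto
  moreover have "infinite (of_nat ` {N<..} :: 'a set)"
    by (simp add: finite_image_iff inj_on_def infinite_Ioi)
  ultimately show False using finite_subset by blast
qed

lemma peak_polynomial_eqI:
  assumes "\<And>n. n > Max (insert 0 S) \<Longrightarrow>
    real (card (peak_perms S n)) = poly p (real n) * 2 ^ (n - card S - 1)"
  shows "peak_polynomial S = p"
  unfolding peak_polynomial_def
proof (rule the_equality)
  fix q
  assume q: "\<forall>n > Max (insert 0 S).
    real (card (peak_perms S n)) = poly q (real n) * 2 ^ (n - card S - 1)"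
  show "q = p"
    by (rule poly_eq_if_eventually_eq_on_nat[of "Max (insert 0 S)"]) (use q assms in auto)
qed (use assms in auto)

theorem theorem3p2:
  fixes m :: nat
  assumes "m \<ge> 4"
  shows "admissible {2, m} \<and>
    (\<forall>x::real. poly (peak_polynomial {2, m}) x =
        (real m - 3) * ((x - 2) gchoose (m - 1))
      + (real m - 2) * ((x - 2) gchoose (m - 2))
      - ((x - 2) gchoose 1)) \<and>
    (\<forall>n \<ge> m + 1. real (card (peak_perms {2, m} n)) =
        poly (peak_polynomial {2, m}) (real n) * 2 ^ (n - 3))"
proof -
  let ?g = "\<lambda>x::real. (real m - 3) * ((x - 2) gchoose (m - 1))
      + (real m - 2) * ((x - 2) gchoose (m - 2)) - ((x - 2) gchoose 1)"
  define p where "p = pcompose (smult (real m - 3) (gchoose_poly (m - 1))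
      + smult (real m - 2) (gchoose_poly (m - 2)) - gchoose_poly 1) [:-2, 1:]"
  have p: "poly p x = ?g x" for x
    by (simp add: p_def poly_pcompose)
  have count: "real (card (peak_perms {2, m} n)) = ?g (real n) * 2 ^ (n - 3)" if "n \<ge> m + 1" for n
  proof -
    \<comment> \<open>The set {1..n} has \<open>Suc l + 2\<close> elements, so the count is applied
      with \<open>Suc l\<close> for its n; \<open>2 ^ Suc l\<close> then cancels the doubling and
      leaves \<open>2 ^ (n - 3)\<close>.\<close>
    define j l where "j = m - 3" and "l = n - 3"
    have m: "m = j + 3" and n: "n = l + 3" using assms that by (auto simp: j_def l_def)
    have "real (card (peak_lists {2, j + 3} {1..n})) * 2 =
      (real j * real (Suc l choose (j + 2)) + real (j + 1) * real (Suc l choose (j + 1)) - real (Suc l))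
        * 2 ^ Suc l"
      by (rule card_peak_lists_2_add_3) (use that m n in auto)
    moreover have "real n - 2 = real (Suc l)" using n by simp
    ultimately show ?thesis
      by (simp add: card_peak_perms m n binomial_gbinomial numeral_eq_Suc del: binomial_Suc_Suc)
  qed
  have poly: "peak_polynomial {2, m} = p"
  proof (rule peak_polynomial_eqI)
    fix n assume "n > Max (insert 0 {2, m})"
    moreover have "n - card {2, m} - 1 = n - 3" using assms by simp
    ultimately show "real (card (peak_perms {2, m} n)) = poly p (real n) * 2 ^ (n - card {2, m} - 1)"
      using count[of n] p by simp
  qed
  \<comment> \<open>The witness for admissibility is n = m + 1, where the formula evaluates to (m -
    3) m, positive because m \<ge> 4.\<close>
  have "real (card (peak_perms {2, m} (m + 1))) > 0"
  proof -
    have "real (m + 1) - 2 = real (m - 1)" using assms by simp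
    moreover have "(m - 1) choose (m - 2) = m - 1"
      using assms binomial_symmetric[of 1 "m - 1"] by (simp add: numeral_2_eq_2)
    ultimately have "?g (real (m + 1)) = (real m - 3) + (real m - 2) * real (m - 1) - real (m - 1)"
      by (simp only: binomial_gbinomial[symmetric] binomial_n_n choose_one of_nat_1 mult_1_right)
    also have "\<dots> = (real m - 3) * real m"
      using assms by (simp add: of_nat_diff algebra_simps)
    finally show ?thesis using assms count[of "m + 1"] by simp
  qed
  then have "admissible {2, m}" by (auto simp: admissible_def)
  then show ?thesis using count by (simp add: poly p)
qed

end
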